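(* Consider the problem SecondStage described in the context. Let $\widehat{p}_{j/i},\widehat{p}_{M/ij},\widehat{p}_{m/M}^{\,ij},\widehat{p}_{r/ijm}$ (all positive) be an optimal solution. Then it satisfies the hierarchical extended logit model: with $V_{ijmr}=-g_{ijmr}$, where $g_{ijmr}$ is the generalized route cost evaluated at the link flows of the optimal solution, and $$S_{ijm}=\frac1{\theta_r}\ln\sum_{r\in R_{ijm}}PS^{ijm}_r e^{\theta_rV_{ijmr}},\qquad IV_M^{ij}=\widehat\tau_M\ln\sum_{m\in M}e^{\widehat\theta_m(\overline{V_{ijm}}+S_{ijm})/\widehat\tau_M},\qquad S_{ij}=\frac1{\widehat\theta_m}\ln\sum_{M\in\mathcal{N}}e^{IV_M^{ij}},$$ one has for all $i\in I$, $j\in J$, $M\in\mathcal{N}$, $m\in M$, $r\in R_{ijm}$: $$\widehat p_{j/i}=\frac{e^{\widehat\theta_j(\overline{V_{ij}}+S_{ij})}}{\sum_{j'\in J}e^{\widehat\theta_j(\overline{V_{ij'}}+S_{ij'})}},\qquad \widehat p_{M/ij}=\frac{e^{IV^{ij}_M}}{\sum_{M'\in\mathcal{N}}e^{IV^{ij}_{M'}}},\qquad \widehat p^{\,ij}_{m/M}=\frac{e^{\widehat\theta_m(\overline{V_{ijm}}+S_{ijm})/\widehat\tau_M}}{\sum_{m'\in M}e^{\widehat\theta_m(\overline{V_{ijm'}}+S_{ijm'})/\widehat\tau_M}},$$ $$\widehat p_{r/ijm}=\frac{PS^{ijm}_re^{\theta_rV_{ijmr}}}{\sum_{r'\in R_{ijm}}PS^{ijm}_{r'}e^{\theta_rV_{ijmr'}}},$$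 so that the mode choice probability is $\widehat p_{m/ij}=\widehat p_{M/ij}\,\widehat p^{\,ij}_{m/M}$ for $m\in M$.
   Context: **Sets.** $I$, $J$ are finite nonempty sets of origins and destinations. The finite set of modes is partitioned into nonempty nests, forming the set $\mathcal{N}$. Each mode $m$ has a network with finitely many links $a_m$ (also written $a$). $R_{ijm}$ is a finite nonempty set of routes from $i$ to $j$ on mode $m$. $\delta^{a_m}_{ijr}\in\{0,1\}$ is $1$ if link $a_m$ lies on route $r$ from $i$ to $j$ on mode $m$, and $0$ otherwise. **Data.** Positive (future) total demands $\widetilde{O_i}$; fixed positive parameters $\widehat\theta_j,\widehat\theta_m,\theta_r$ and $\widehat\tau_M$ for each $M\in\mathcal{N}$ (the subscripts in $\widehat\theta_j,\widehat\theta_m,\theta_r$ only name the choice level: destination, mode, route); fixed real deterministic utilities $\overline{V_{ij}}=\sum_k\widehat\beta_k\widetilde{X^k_{ij}}$ and $\overline{V_{ijm}}=\sum_q\widehat\beta_q\widetilde{X^q_{ijm}}$, computed from given real parameters $\widehat\beta_k,\widehat\beta_q$ and given real attributes $\widetilde{X^k_{ij}},\widetilde{X^q_{ijm}}$; and path-size factors $$PS^{ijm}_r=\sum_{a_m\in r}\frac{l_{a_m}}{L^{ijm}_r}\Big(\frac1{\sum_{r'\in R_{ijm}}\delta^{a_m}_{ijr'}}\Big),$$ where $l_{a_m}>0$ is the length of link $a_m$ and $L^{ijm}_r$ is the length of route $r$. **Costs (standing assumption).** The generalized link cost $g^m_a$ is continuous, differentiable, strictly increasing and separable (it depends only on the flow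 $f^m_a$ of its own link and mode), and route costs are additive: $g_{ijmr}=\sum_{a_m}g^m_a(f^m_a)\,\delta^{a_m}_{ijr}$. **Problem SecondStage.** The variables are positive numbers $p_{j/i}$, $p_{M/ij}$, $p^{ij}_{m/M}$ ($m\in M$), $p_{r/ijm}$. Below, sums over $m$ appearing together with $M$ run over $m\in M$, and sums over $r$ run over $R_{ijm}$. Maximize $$-\frac1{\widehat\theta_j}\sum_{i,j}\widetilde{O_i}\,p_{j/i}\ln p_{j/i}-\frac1{\widehat\theta_m}\Big[\sum_{i,j,M}\widetilde{O_i}\,p_{j/i}\,p_{M/ij}\ln p_{M/ij}+\sum_M\widehat\tau_M\sum_{i,j}\sum_{m\in M}\widetilde{O_i}\,p_{j/i}\,p_{M/ij}\,p^{ij}_{m/M}\ln p^{ij}_{m/M}\Big]$$ $$-\frac1{\theta_r}\sum_{i,j,M,m,r}\widetilde{O_i}\,p_{j/i}\,p_{M/ij}\,p^{ij}_{m/M}\,p_{r/ijm}\ln\frac{p_{r/ijm}}{PS^{ijm}_r}-\sum_m\sum_{a_m}\int_0^{f^m_a}g^m_a(w)\,dw$$ $$+\sum_{i,j}\widetilde{O_i}\,p_{j/i}\overline{V_{ij}}+\sum_{i,j,M,m}\widetilde{O_i}\,p_{j/i}\,p_{M/ij}\,p^{ij}_{m/M}\overline{V_{ijm}},$$ where, for $m\in M$, $f^m_a=\sum_{i,j,r}\widetilde{O_i}\,p_{j/i}\,p_{M/ij}\,p^{ij}_{m/M}\,p_{r/ijm}\,\delta^{a_m}_{ijr}$, subject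 to $\sum_jp_{j/i}=1$ for all $i$; $\sum_Mp_{M/ij}=1$ for all $i,j$; $\sum_{m\in M}p^{ij}_{m/M}=1$ for all $i,j,M$; $\sum_rp_{r/ijm}=1$ for all $i,j,m$. *)

theory Defs
  imports "HOL-Analysis.Analysis"
begin

text \<open>
  Type variables: origins \<open>'i\<close>, destinations \<open>'j\<close>, modes \<open>'m\<close>, links \<open>'a\<close>, routes \<open>'r\<close>,
  and indices \<open>'k\<close>, \<open>'q\<close> of the attributes entering the destination and the mode utilities.
  A nest is a set of modes.  A route is an abstract object whose links are given by
  \<open>route_links D i j m r\<close>; distinct routes may use the same links.  The cost of a link is a
  function of the flow of that link and mode only, i.e. it is separable.
\<close>

record ('i, 'j, 'm, 'a, 'r, 'k, 'q) network_data =
  origins :: "'i set"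
  dests :: "'j set"
  modes :: "'m set"
  nests :: "'m set set"
  links :: "'m \<Rightarrow> 'a set"
  routes :: "'i \<Rightarrow> 'j \<Rightarrow> 'm \<Rightarrow> 'r set"
  route_links :: "'i \<Rightarrow> 'j \<Rightarrow> 'm \<Rightarrow> 'r \<Rightarrow> 'a set"
  link_length :: "'m \<Rightarrow> 'a \<Rightarrow> real"
  link_cost :: "'m \<Rightarrow> 'a \<Rightarrow> real \<Rightarrow> real"
  demand :: "'i \<Rightarrow> real"
  theta_dest :: real
  theta_mode :: real
  theta_route :: real
  tau :: "'m set \<Rightarrow> real"
  dest_attrs :: "'k set"
  dest_beta :: "'k \<Rightarrow> real"
  dest_attr :: "'k \<Rightarrow> 'i \<Rightarrow> 'j \<Rightarrow> real"
  mode_attrs :: "'q set"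
  mode_beta :: "'q \<Rightarrow> real"
  mode_attr :: "'q \<Rightarrow> 'i \<Rightarrow> 'j \<Rightarrow> 'm \<Rightarrow> real"

text \<open>
  Link costs are only constrained on nonnegative flows.  Routes have at least one link, as is
  needed for the path-size factors to be well defined (positive route length).
\<close>

locale second_stage_data =
  fixes D :: "('i, 'j, 'm, 'a, 'r, 'k, 'q) network_data"
  assumes origins: "finite (origins D)" "origins D \<noteq> {}"
    and dests: "finite (dests D)" "dests D \<noteq> {}"
    and modes: "finite (modes D)"
    and nests: "partition_on (modes D) (nests D)"
    and links: "m \<in> modes D \<Longrightarrow> finite (links D m)"
    and routes:
      "\<lbrakk>i \<in> origins D; j \<in> dests D; m \<in> modes D\<rbrakk> \<Longrightarrow> finite (routes D i j m)"
      "\<lbrakk>i \<in> origins D; j \<in> dests D; m \<in> modes D\<rbrakk> \<Longrightarrow> routes D i j m \<noteq> {}"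
    and route_links:
      "\<lbrakk>i \<in> origins D; j \<in> dests D; m \<in> modes D; r \<in> routes D i j m\<rbrakk>
        \<Longrightarrow> route_links D i j m r \<subseteq> links D m"
      "\<lbrakk>i \<in> origins D; j \<in> dests D; m \<in> modes D; r \<in> routes D i j m\<rbrakk>
        \<Longrightarrow> route_links D i j m r \<noteq> {}"
    and link_length: "\<lbrakk>m \<in> modes D; a \<in> links D m\<rbrakk> \<Longrightarrow> 0 < link_length D m a"
    and link_cost:
      "\<lbrakk>m \<in> modes D; a \<in> links D m\<rbrakk> \<Longrightarrow> continuous_on {0..} (link_cost D m a)"
      "\<lbrakk>m \<in> modes D; a \<in> links D m\<rbrakk> \<Longrightarrow> link_cost D m a differentiable_on {0..}"
      "\<lbrakk>m \<in> modes D; a \<in> links D m\<rbrakk> \<Longrightarrow> strict_mono_on {0..} (link_cost D m a)"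
    and demand: "i \<in> origins D \<Longrightarrow> 0 < demand D i"
    and theta: "0 < theta_dest D" "0 < theta_mode D" "0 < theta_route D"
    and tau: "M \<in> nests D \<Longrightarrow> 0 < tau D M"
    and attrs: "finite (dest_attrs D)" "finite (mode_attrs D)"

definition dest_utility ::
    "('i, 'j, 'm, 'a, 'r, 'k, 'q) network_data \<Rightarrow> 'i \<Rightarrow> 'j \<Rightarrow> real" where
  "dest_utility D i j = (\<Sum>k\<in>dest_attrs D. dest_beta D k * dest_attr D k i j)"

definition mode_utility ::
    "('i, 'j, 'm, 'a, 'r, 'k, 'q) network_data \<Rightarrow> 'i \<Rightarrow> 'j \<Rightarrow> 'm \<Rightarrow> real" where
  "mode_utility D i j m = (\<Sum>q\<in>mode_attrs D. mode_beta D q * mode_attr D q i j m)"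

definition incidence ::
    "('i, 'j, 'm, 'a, 'r, 'k, 'q) network_data \<Rightarrow> 'i \<Rightarrow> 'j \<Rightarrow> 'm \<Rightarrow> 'r \<Rightarrow> 'a \<Rightarrow> real" where
  "incidence D i j m r a = (if a \<in> route_links D i j m r then 1 else 0)"

definition route_length ::
    "('i, 'j, 'm, 'a, 'r, 'k, 'q) network_data \<Rightarrow> 'i \<Rightarrow> 'j \<Rightarrow> 'm \<Rightarrow> 'r \<Rightarrow> real" where
  "route_length D i j m r = (\<Sum>a\<in>route_links D i j m r. link_length D m a)"

definition path_size ::
    "('i, 'j, 'm, 'a, 'r, 'k, 'q) network_data \<Rightarrow> 'i \<Rightarrow> 'j \<Rightarrow> 'm \<Rightarrow> 'r \<Rightarrow> real" where
  "path_size D i j m r =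
    (\<Sum>a\<in>route_links D i j m r.
      link_length D m a / route_length D i j m r
        * (1 / (\<Sum>r'\<in>routes D i j m. incidence D i j m r' a)))"

text \<open>
  The fields stand for \<open>p\<^bsub>j/i\<^esub>\<close>, \<open>p\<^bsub>M/ij\<^esub>\<close>, \<open>p\<^sup>i\<^sup>j\<^bsub>m/M\<^esub>\<close> and \<open>p\<^bsub>r/ijm\<^esub>\<close>.  Only their values on
  the index sets of the data matter.
\<close>

record ('i, 'j, 'm, 'r) choice_probs =
  dest_prob :: "'i \<Rightarrow> 'j \<Rightarrow> real"
  nest_prob :: "'i \<Rightarrow> 'j \<Rightarrow> 'm set \<Rightarrow> real"
  mode_in_nest_prob :: "'i \<Rightarrow> 'j \<Rightarrow> 'm set \<Rightarrow> 'm \<Rightarrow> real"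
  route_prob :: "'i \<Rightarrow> 'j \<Rightarrow> 'm \<Rightarrow> 'r \<Rightarrow> real"

definition nest_of :: "('i, 'j, 'm, 'a, 'r, 'k, 'q) network_data \<Rightarrow> 'm \<Rightarrow> 'm set" where
  "nest_of D m = (THE M. M \<in> nests D \<and> m \<in> M)"

definition link_flow ::
    "('i, 'j, 'm, 'a, 'r, 'k, 'q) network_data \<Rightarrow> ('i, 'j, 'm, 'r) choice_probs
      \<Rightarrow> 'm \<Rightarrow> 'a \<Rightarrow> real" where
  "link_flow D p m a =
    (\<Sum>i\<in>origins D. \<Sum>j\<in>dests D. \<Sum>r\<in>routes D i j m.
      demand D i * dest_prob p i j * nest_prob p i j (nest_of D m)
        * mode_in_nest_prob p i j (nest_of D m) m * route_prob p i j m r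
        * incidence D i j m r a)"

definition route_cost ::
    "('i, 'j, 'm, 'a, 'r, 'k, 'q) network_data \<Rightarrow> ('i, 'j, 'm, 'r) choice_probs
      \<Rightarrow> 'i \<Rightarrow> 'j \<Rightarrow> 'm \<Rightarrow> 'r \<Rightarrow> real" where
  "route_cost D p i j m r =
    (\<Sum>a\<in>links D m. link_cost D m a (link_flow D p m a) * incidence D i j m r a)"

definition objective ::
    "('i, 'j, 'm, 'a, 'r, 'k, 'q) network_data \<Rightarrow> ('i, 'j, 'm, 'r) choice_probs \<Rightarrow> real" where
  "objective D p =
    - (1 / theta_dest D)
        * (\<Sum>i\<in>origins D. \<Sum>j\<in>dests D. demand D i * dest_prob p i j * ln (dest_prob p i j))
    - (1 / theta_mode D)
        * ((\<Sum>i\<in>origins D. \<Sum>j\<in>dests D. \<Sum>M\<in>nests D.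
              demand D i * dest_prob p i j * nest_prob p i j M * ln (nest_prob p i j M))
          + (\<Sum>M\<in>nests D. tau D M
              * (\<Sum>i\<in>origins D. \<Sum>j\<in>dests D. \<Sum>m\<in>M.
                  demand D i * dest_prob p i j * nest_prob p i j M
                    * mode_in_nest_prob p i j M m * ln (mode_in_nest_prob p i j M m))))
    - (1 / theta_route D)
        * (\<Sum>i\<in>origins D. \<Sum>j\<in>dests D. \<Sum>M\<in>nests D. \<Sum>m\<in>M. \<Sum>r\<in>routes D i j m.
            demand D i * dest_prob p i j * nest_prob p i j M * mode_in_nest_prob p i j M m
              * route_prob p i j m r * ln (route_prob p i j m r / path_size D i j m r))
    - (\<Sum>m\<in>modes D. \<Sum>a\<in>links D m. integral {0..link_flow D p m a} (link_cost D m a))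
    + (\<Sum>i\<in>origins D. \<Sum>j\<in>dests D. demand D i * dest_prob p i j * dest_utility D i j)
    + (\<Sum>i\<in>origins D. \<Sum>j\<in>dests D. \<Sum>M\<in>nests D. \<Sum>m\<in>M.
        demand D i * dest_prob p i j * nest_prob p i j M * mode_in_nest_prob p i j M m
          * mode_utility D i j m)"

definition feasible ::
    "('i, 'j, 'm, 'a, 'r, 'k, 'q) network_data \<Rightarrow> ('i, 'j, 'm, 'r) choice_probs \<Rightarrow> bool" where
  "feasible D p \<longleftrightarrow>
    (\<forall>i\<in>origins D. \<forall>j\<in>dests D. 0 < dest_prob p i j) \<and>
    (\<forall>i\<in>origins D. \<forall>j\<in>dests D. \<forall>M\<in>nests D. 0 < nest_prob p i j M) \<and>
    (\<forall>i\<in>origins D. \<forall>j\<in>dests D. \<forall>M\<in>nests D. \<forall>m\<in>M. 0 < mode_in_nest_prob p i j M m) \<and>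
    (\<forall>i\<in>origins D. \<forall>j\<in>dests D. \<forall>m\<in>modes D. \<forall>r\<in>routes D i j m. 0 < route_prob p i j m r) \<and>
    (\<forall>i\<in>origins D. (\<Sum>j\<in>dests D. dest_prob p i j) = 1) \<and>
    (\<forall>i\<in>origins D. \<forall>j\<in>dests D. (\<Sum>M\<in>nests D. nest_prob p i j M) = 1) \<and>
    (\<forall>i\<in>origins D. \<forall>j\<in>dests D. \<forall>M\<in>nests D. (\<Sum>m\<in>M. mode_in_nest_prob p i j M m) = 1) \<and>
    (\<forall>i\<in>origins D. \<forall>j\<in>dests D. \<forall>m\<in>modes D. (\<Sum>r\<in>routes D i j m. route_prob p i j m r) = 1)"

definition optimal_solution ::
    "('i, 'j, 'm, 'a, 'r, 'k, 'q) network_data \<Rightarrow> ('i, 'j, 'm, 'r) choice_probs \<Rightarrow> bool" where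
  "optimal_solution D p \<longleftrightarrow>
    feasible D p \<and> (\<forall>q. feasible D q \<longrightarrow> objective D q \<le> objective D p)"

text \<open>The law of total probability over the nests, a mode having probability 0 outside its nest.\<close>

definition mode_prob ::
    "('i, 'j, 'm, 'a, 'r, 'k, 'q) network_data \<Rightarrow> ('i, 'j, 'm, 'r) choice_probs
      \<Rightarrow> 'i \<Rightarrow> 'j \<Rightarrow> 'm \<Rightarrow> real" where
  "mode_prob D p i j m =
    (\<Sum>M\<in>nests D. nest_prob p i j M * (if m \<in> M then mode_in_nest_prob p i j M m else 0))"

text \<open>In order: \<open>V\<^bsub>ijmr\<^esub>\<close>, \<open>S\<^bsub>ijm\<^esub>\<close>, \<open>IV\<^sup>i\<^sup>j\<^bsub>M\<^esub>\<close> and \<open>S\<^bsub>ij\<^esub>\<close>, at the link flows induced by \<open>p\<close>.\<close>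

definition route_utility ::
    "('i, 'j, 'm, 'a, 'r, 'k, 'q) network_data \<Rightarrow> ('i, 'j, 'm, 'r) choice_probs
      \<Rightarrow> 'i \<Rightarrow> 'j \<Rightarrow> 'm \<Rightarrow> 'r \<Rightarrow> real" where
  "route_utility D p i j m r = - route_cost D p i j m r"

definition route_logsum ::
    "('i, 'j, 'm, 'a, 'r, 'k, 'q) network_data \<Rightarrow> ('i, 'j, 'm, 'r) choice_probs
      \<Rightarrow> 'i \<Rightarrow> 'j \<Rightarrow> 'm \<Rightarrow> real" where
  "route_logsum D p i j m =
    1 / theta_route D
      * ln (\<Sum>r\<in>routes D i j m.
          path_size D i j m r * exp (theta_route D * route_utility D p i j m r))"

definition nest_inclusive_value ::
    "('i, 'j, 'm, 'a, 'r, 'k, 'q) network_data \<Rightarrow> ('i, 'j, 'm, 'r) choice_probs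
      \<Rightarrow> 'i \<Rightarrow> 'j \<Rightarrow> 'm set \<Rightarrow> real" where
  "nest_inclusive_value D p i j M =
    tau D M
      * ln (\<Sum>m\<in>M.
          exp (theta_mode D * (mode_utility D i j m + route_logsum D p i j m) / tau D M))"

definition mode_logsum ::
    "('i, 'j, 'm, 'a, 'r, 'k, 'q) network_data \<Rightarrow> ('i, 'j, 'm, 'r) choice_probs
      \<Rightarrow> 'i \<Rightarrow> 'j \<Rightarrow> real" where
  "mode_logsum D p i j =
    1 / theta_mode D * ln (\<Sum>M\<in>nests D. exp (nest_inclusive_value D p i j M))"

end

theory Submission
  imports Defs
begin

text \<open>
  Replace the Beckmann term of the objective by its linearisation at the link flows of the optimum
  \<open>p\<close>.  The result is a nested sum: at every level it has the form \<open>\<Sum>k. x k * \<phi> k\<close> with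
  \<open>\<phi> k = v k - c * ln (x k / w k)\<close>, where \<open>v k\<close> contains the value of the next lower level.  Perturb
  all levels simultaneously in the replicator direction \<open>d k = x k * (\<phi> k - E)\<close>, where
  \<open>E = (\<Sum>k. x k * \<phi> k)\<close>.  As \<open>\<Sum>k. d k = 0\<close>, small perturbations are feasible, and the derivative
  of the objective is a nested positive combination of the variances \<open>\<Sum>k. x k * (\<phi> k - E)\<^sup>2\<close>.
  It vanishes at an optimum, so \<open>\<phi>\<close> is constant at every level, which is the logit formula, and the
  constant is the logsum that enters the next higher level.
\<close>

section \<open>A single choice level: entropic value, replicator direction, logit formula\<close>

definition choice_value ::
    "'k set \<Rightarrow> real \<Rightarrow> ('k \<Rightarrow> real) \<Rightarrow> ('k \<Rightarrow> real) \<Rightarrow> ('k \<Rightarrow> real) \<Rightarrow> real" where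
  "choice_value K c w v x = (\<Sum>k\<in>K. x k * (v k - c * ln (x k / w k)))"

text \<open>\<open>choice_value\<close> is the expected utility minus \<open>c\<close> times the
  relative entropy of \<open>x\<close> with respect to the weights \<open>w\<close>. The curve here
  is affine in \<open>t\<close>; its direction is the gradient of that value in the Fisher metric on
  the simplex. The factor \<open>x k\<close> in front of the bracket keeps every coordinate positive
  for small \<open>t\<close>.\<close>

definition replicator ::
    "'k set \<Rightarrow> real \<Rightarrow> ('k \<Rightarrow> real) \<Rightarrow> ('k \<Rightarrow> real) \<Rightarrow> ('k \<Rightarrow> real) \<Rightarrow> real \<Rightarrow> 'k \<Rightarrow> real" where
  "replicator K c w v x t k = x k * (1 + t * (v k - c * ln (x k / w k) - choice_value K c w v x))"

lemma replicator_0 [simp]: "replicator K c w v x 0 = x"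
  by (simp add: replicator_def fun_eq_iff)

lemma sum_replicator:
  assumes "(\<Sum>k\<in>K. x k) = 1"
  shows "(\<Sum>k\<in>K. replicator K c w v x t k) = 1"
proof -
  let ?E = "choice_value K c w v x"
  have "(\<Sum>k\<in>K. replicator K c w v x t k)
      = (\<Sum>k\<in>K. x k + t * (x k * (v k - c * ln (x k / w k))) - t * ?E * x k)"
    by (rule sum.cong) (simp_all add: replicator_def algebra_simps)
  also have "\<dots> = (\<Sum>k\<in>K. x k) + t * ?E - t * ?E * (\<Sum>k\<in>K. x k)"
    by (simp add: sum.distrib sum_subtractf choice_value_def flip: sum_distrib_left)
  finally show ?thesis
    using assms by simp
qed

lemma replicator_differentiable: "(\<lambda>t. replicator K c w v x t k) differentiable at t"
  unfolding replicator_def by (auto intro!: derivative_intros)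

lemma eventually_replicator_pos:
  assumes "0 < x k"
  shows "\<forall>\<^sub>F t in nhds 0. 0 < replicator K c w v x t k"
proof -
  have "((\<lambda>t. replicator K c w v x t k) \<longlongrightarrow> replicator K c w v x 0 k) (nhds 0)"
    unfolding replicator_def by (intro tendsto_intros filterlim_ident)
  then show ?thesis
    using assms by (simp add: order_tendstoD)
qed

text \<open>The utilities \<open>v t\<close> may move with \<open>t\<close>, since at an upper level
  they contain the value of the level below; the direction uses only \<open>v0\<close>, their state
  at 0. The product rule yields the variance of the perceived utilities, and the derivatives
  \<open>v'\<close> of the lower values are averaged with weights \<open>x\<close>.\<close>

lemma choice_value_replicator_deriv:
  fixes v :: "real \<Rightarrow> 'k \<Rightarrow> real"
  assumes "\<And>k. k \<in> K \<Longrightarrow> 0 < x k" "\<And>k. k \<in> K \<Longrightarrow> 0 < w k"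
    and sum1: "(\<Sum>k\<in>K. x k) = 1"
    and v: "\<And>k. k \<in> K \<Longrightarrow> ((\<lambda>t. v t k) has_real_derivative v' k) (at 0)"
    and v0: "v 0 = v0"
  shows "((\<lambda>t. choice_value K c w (v t) (replicator K c w v0 x t)) has_real_derivative
      (\<Sum>k\<in>K. x k * ((v0 k - c * ln (x k / w k) - choice_value K c w v0 x)\<^sup>2 + v' k))) (at 0)"
proof -
  let ?E = "choice_value K c w v0 x"
  define \<phi> where "\<phi> k = v0 k - c * ln (x k / w k)" for k
  have r: "((\<lambda>t. replicator K c w v0 x t k) has_real_derivative x k * (\<phi> k - ?E)) (at 0)" for k
    unfolding replicator_def \<phi>_def by (auto intro!: derivative_eq_intros)
  have "((\<lambda>t. replicator K c w v0 x t k * (v t k - c * ln (replicator K c w v0 x t k / w k)))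
      has_real_derivative x k * (\<phi> k - ?E) * \<phi> k + x k * v' k - c * (x k * (\<phi> k - ?E))) (at 0)"
    if "k \<in> K" for k
    using assms(1,2)[OF that]
    by (auto intro!: derivative_eq_intros r v that simp: v0 \<phi>_def field_simps)
  then have "((\<lambda>t. choice_value K c w (v t) (replicator K c w v0 x t)) has_real_derivative
      (\<Sum>k\<in>K. x k * (\<phi> k - ?E) * \<phi> k + x k * v' k - c * (x k * (\<phi> k - ?E)))) (at 0)"
    unfolding choice_value_def[of _ _ _ "v _"] by (intro DERIV_sum)
  moreover have "(\<Sum>k\<in>K. x k * (\<phi> k - ?E)) = 0"
  proof -
    have "(\<Sum>k\<in>K. x k * (\<phi> k - ?E)) = (\<Sum>k\<in>K. x k * \<phi> k) - (\<Sum>k\<in>K. x k) * ?E"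
      by (simp add: right_diff_distrib sum_subtractf sum_distrib_right)
    then show ?thesis
      using sum1 by (simp add: choice_value_def \<phi>_def)
  qed
  \<comment> \<open>As the directions sum to zero, the entropy contribution with factor
    \<open>c\<close> vanishes and may be exchanged for one with factor \<open>?E\<close>, which
    completes the square.\<close>
  then have "(\<Sum>k\<in>K. x k * (\<phi> k - ?E) * \<phi> k + x k * v' k - c * (x k * (\<phi> k - ?E)))
      = (\<Sum>k\<in>K. x k * (\<phi> k - ?E) * \<phi> k + x k * v' k) - ?E * (\<Sum>k\<in>K. x k * (\<phi> k - ?E))"
    by (simp add: sum_subtractf flip: sum_distrib_left)
  also have "\<dots> = (\<Sum>k\<in>K. x k * ((\<phi> k - ?E)\<^sup>2 + v' k))"
    unfolding sum_distrib_left sum_subtractf[symmetric]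
    by (rule sum.cong) (simp_all add: power2_eq_square algebra_simps)
  ultimately show ?thesis
    by (simp add: \<phi>_def)
qed

text \<open>Only route choice carries weights, the path-size factors; the three upper levels have
  weight 1.\<close>

lemmas choice_value_replicator_deriv_unweighted =
  choice_value_replicator_deriv[where w = "\<lambda>_. 1", simplified]

text \<open>Exponentiating the stationarity condition gives
  \<open>w k * exp (v k / c) = x k * exp (E / c)\<close>, with \<open>E\<close> the common value.
  Summation over \<open>K\<close> identifies \<open>exp (E / c)\<close> as the logit denominator, so
  that \<open>E\<close> is the logsum.\<close>

lemma stationary_choice_logit:
  assumes "0 < c"
    and x: "\<And>k. k \<in> K \<Longrightarrow> 0 < x k" and w: "\<And>k. k \<in> K \<Longrightarrow> 0 < w k"
    and sum1: "(\<Sum>k\<in>K. x k) = 1"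
    and stat: "\<And>k. k \<in> K \<Longrightarrow> v k - c * ln (x k / w k) = choice_value K c w v x"
  shows stationary_choice_prob:
      "k \<in> K \<Longrightarrow> x k = w k * exp (v k / c) / (\<Sum>k\<in>K. w k * exp (v k / c))"
    and stationary_choice_value:
      "choice_value K c w v x = c * ln (\<Sum>k\<in>K. w k * exp (v k / c))"
proof -
  let ?E = "choice_value K c w v x"
  have e: "w k * exp (v k / c) = x k * exp (?E / c)" if "k \<in> K" for k
  proof -
    have "v k / c = ln (x k / w k) + ?E / c"
      using stat[OF that] \<open>0 < c\<close> by (simp add: field_simps)
    then show ?thesis
      using x[OF that] w[OF that] by (simp add: exp_add)
  qed
  then have s: "(\<Sum>k\<in>K. w k * exp (v k / c)) = exp (?E / c)"
    using sum1 by (simp flip: sum_distrib_right)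
  show "x k = w k * exp (v k / c) / (\<Sum>k\<in>K. w k * exp (v k / c))" if "k \<in> K"
    using e[OF that] s by simp
  show "?E = c * ln (\<Sum>k\<in>K. w k * exp (v k / c))"
    using \<open>0 < c\<close> by (simp add: s)
qed

text \<open>One step of the descent through the nested derivative: \<open>a\<close> holds the
  deviations at the current level and \<open>b\<close> the variance sums of the level below. Taking
  \<open>a = 0\<close> covers the sum over origins, taking \<open>b = 0\<close> the routes.\<close>

lemma weighted_squares_zero:
  fixes x a b :: "'k \<Rightarrow> real"
  assumes "finite K" and sum0: "(\<Sum>k\<in>K. x k * ((a k)\<^sup>2 + b k)) = 0"
    and pos: "\<And>k. k \<in> K \<Longrightarrow> 0 < x k" and nonneg: "\<And>k. k \<in> K \<Longrightarrow> 0 \<le> b k" and k: "k \<in> K"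
  shows "a k = 0 \<and> b k = 0"
proof -
  have "x k * ((a k)\<^sup>2 + b k) = 0"
    using assms(1) sum0 k by (subst (asm) sum_nonneg_eq_0_iff) (auto simp: pos nonneg less_imp_le)
  then show ?thesis
    using pos[OF k] nonneg[OF k] by (simp add: add_nonneg_eq_0_iff)
qed

section \<open>The linearised objective as a nested value, and its perturbation\<close>

definition route_value where
  "route_value D G q i j m =
    choice_value (routes D i j m) (1 / theta_route D) (path_size D i j m) (\<lambda>r. - G i j m r)
      (route_prob q i j m)"

definition nest_value where
  "nest_value D G q i j M =
    choice_value M (tau D M / theta_mode D) (\<lambda>_. 1)
      (\<lambda>m. mode_utility D i j m + route_value D G q i j m) (mode_in_nest_prob q i j M)"

definition dest_value where
  "dest_value D G q i j =
    choice_value (nests D) (1 / theta_mode D) (\<lambda>_. 1) (nest_value D G q i j) (nest_prob q i j)"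

definition origin_value where
  "origin_value D G q i =
    choice_value (dests D) (1 / theta_dest D) (\<lambda>_. 1)
      (\<lambda>j. dest_utility D i j + dest_value D G q i j) (dest_prob q i)"

text \<open>The route costs \<open>G\<close> are an argument and do not follow the flows of
  \<open>q\<close>. For \<open>G = route_cost D p\<close> this is the objective with its Beckmann
  term replaced by the linear function of the link flows whose slopes are the link costs at
  \<open>p\<close>.\<close>

definition total_value where
  "total_value D G q = (\<Sum>i\<in>origins D. demand D i * origin_value D G q i)"

text \<open>All values inside the directions are taken at \<open>p\<close>, so each probability is
  affine in \<open>t\<close>; the values at the perturbed point enter only when the objective is
  evaluated there.\<close>

definition perturbed where
  "perturbed D G p t =
    \<lparr>dest_prob = \<lambda>i. replicator (dests D) (1 / theta_dest D) (\<lambda>_. 1)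
        (\<lambda>j. dest_utility D i j + dest_value D G p i j) (dest_prob p i) t,
     nest_prob = \<lambda>i j. replicator (nests D) (1 / theta_mode D) (\<lambda>_. 1)
        (nest_value D G p i j) (nest_prob p i j) t,
     mode_in_nest_prob = \<lambda>i j M. replicator M (tau D M / theta_mode D) (\<lambda>_. 1)
        (\<lambda>m. mode_utility D i j m + route_value D G p i j m) (mode_in_nest_prob p i j M) t,
     route_prob = \<lambda>i j m. replicator (routes D i j m) (1 / theta_route D) (path_size D i j m)
        (\<lambda>r. - G i j m r) (route_prob p i j m) t\<rparr>"

lemma perturbed_0 [simp]: "perturbed D G p 0 = p"
  by (simp add: perturbed_def)

lemma perturbed_sel:
  "dest_prob (perturbed D G p t) i = replicator (dests D) (1 / theta_dest D) (\<lambda>_. 1)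
      (\<lambda>j. dest_utility D i j + dest_value D G p i j) (dest_prob p i) t"
  "nest_prob (perturbed D G p t) i j = replicator (nests D) (1 / theta_mode D) (\<lambda>_. 1)
      (nest_value D G p i j) (nest_prob p i j) t"
  "mode_in_nest_prob (perturbed D G p t) i j M = replicator M (tau D M / theta_mode D) (\<lambda>_. 1)
      (\<lambda>m. mode_utility D i j m + route_value D G p i j m) (mode_in_nest_prob p i j M) t"
  "route_prob (perturbed D G p t) i j m =
    replicator (routes D i j m) (1 / theta_route D) (path_size D i j m)
      (\<lambda>r. - G i j m r) (route_prob p i j m) t"
  by (simp_all add: perturbed_def)

section \<open>Nests and path-size factors\<close>

context second_stage_data
begin

lemma finite_nests: "finite (nests D)"
  using nests modes by (rule finite_elements[rotated])

lemma nest_subset: "M \<in> nests D \<Longrightarrow> M \<subseteq> modes D"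
  using nests by (auto simp: partition_on_def)

lemma finite_nest: "M \<in> nests D \<Longrightarrow> finite M"
  using nest_subset modes by (rule finite_subset)

lemma nest_unique: "\<lbrakk>M \<in> nests D; M' \<in> nests D; m \<in> M; m \<in> M'\<rbrakk> \<Longrightarrow> M = M'"
  using nests by (auto simp: partition_on_def disjoint_def)

lemma nest_of_eq: "\<lbrakk>M \<in> nests D; m \<in> M\<rbrakk> \<Longrightarrow> nest_of D m = M"
  unfolding nest_of_def by (rule the_equality) (use nest_unique in auto)

lemma mode_prob_eq:
  assumes "M \<in> nests D" "m \<in> M"
  shows "mode_prob D p i j m = nest_prob p i j M * mode_in_nest_prob p i j M m"
proof -
  have "mode_prob D p i j m
      = (\<Sum>N\<in>nests D. if N = M then nest_prob p i j M * mode_in_nest_prob p i j M m else 0)"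
    unfolding mode_prob_def
    using assms nest_unique by (intro sum.cong) auto
  then show ?thesis
    using assms finite_nests by simp
qed

lemma sum_modes: "(\<Sum>m\<in>modes D. f m) = (\<Sum>M\<in>nests D. \<Sum>m\<in>M. f m)"
proof -
  have "modes D = \<Union>(nests D)"
    using nests by (simp add: partition_on_def)
  moreover have "(\<Sum>m\<in>\<Union>(nests D). f m) = (\<Sum>M\<in>nests D. \<Sum>m\<in>M. f m)"
    using finite_nest nest_unique by (subst sum.Union_disjoint) (auto simp: comp_def)
  ultimately show ?thesis
    by simp
qed

lemma path_size_pos:
  assumes "i \<in> origins D" "j \<in> dests D" "m \<in> modes D" "r \<in> routes D i j m"
  shows "0 < path_size D i j m r"
proof -
  note sub = route_links(1)[OF assms] and ne = route_links(2)[OF assms]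
  have fin: "finite (route_links D i j m r)"
    using sub links[OF assms(3)] by (rule finite_subset)
  have pos: "0 < link_length D m a" if "a \<in> route_links D i j m r" for a
    using that sub link_length[OF assms(3)] by blast
  then have len: "0 < route_length D i j m r"
    unfolding route_length_def using fin ne by (intro sum_pos) auto
  \<comment> \<open>The number of routes through \<open>a\<close> is positive because
    \<open>r\<close> itself is one of them.\<close>
  have "0 < (\<Sum>r'\<in>routes D i j m. incidence D i j m r' a)" if "a \<in> route_links D i j m r" for a
    using that assms routes(1)[OF assms(1-3)]
    by (intro sum_pos2[of _ r]) (auto simp: incidence_def)
  then show ?thesis
    unfolding path_size_def using fin ne pos len by (intro sum_pos) auto
qed

section \<open>Linearisation of the Beckmann term\<close>

lemma sum_link_flow:
  "(\<Sum>m\<in>modes D. \<Sum>a\<in>links D m. c m a * link_flow D q m a) =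
    (\<Sum>i\<in>origins D. \<Sum>j\<in>dests D. \<Sum>M\<in>nests D. \<Sum>m\<in>M. \<Sum>r\<in>routes D i j m.
      demand D i * dest_prob q i j * nest_prob q i j M * mode_in_nest_prob q i j M m
        * route_prob q i j m r * (\<Sum>a\<in>links D m. c m a * incidence D i j m r a))"
proof -
  let ?x = "\<lambda>i j M m r. demand D i * dest_prob q i j * nest_prob q i j M
    * mode_in_nest_prob q i j M m * route_prob q i j m r"
  have "(\<Sum>a\<in>links D m. c m a * link_flow D q m a) = (\<Sum>i\<in>origins D. \<Sum>j\<in>dests D.
      \<Sum>r\<in>routes D i j m. ?x i j M m r * (\<Sum>a\<in>links D m. c m a * incidence D i j m r a))"
    if "M \<in> nests D" "m \<in> M" for M m
  proof -
    have "(\<Sum>a\<in>links D m. c m a * link_flow D q m a) = (\<Sum>a\<in>links D m. \<Sum>i\<in>origins D.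
        \<Sum>j\<in>dests D. \<Sum>r\<in>routes D i j m. ?x i j M m r * (c m a * incidence D i j m r a))"
      by (simp add: link_flow_def nest_of_eq[OF that] sum_distrib_left mult_ac)
    then show ?thesis
      by (simp add: sum_distrib_left sum.swap[of _ _ "links D m"])
  qed
  then have "(\<Sum>m\<in>modes D. \<Sum>a\<in>links D m. c m a * link_flow D q m a) =
      (\<Sum>M\<in>nests D. \<Sum>m\<in>M. \<Sum>i\<in>origins D. \<Sum>j\<in>dests D.
        \<Sum>r\<in>routes D i j m. ?x i j M m r * (\<Sum>a\<in>links D m. c m a * incidence D i j m r a))"
    unfolding sum_modes by (intro sum.cong refl)
  also have "\<dots> = (\<Sum>M\<in>nests D. \<Sum>i\<in>origins D. \<Sum>j\<in>dests D. \<Sum>m\<in>M.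
        \<Sum>r\<in>routes D i j m. ?x i j M m r * (\<Sum>a\<in>links D m. c m a * incidence D i j m r a))"
    by (intro sum.cong refl) (subst sum.swap, intro sum.cong refl, rule sum.swap)
  also have "\<dots> = (\<Sum>i\<in>origins D. \<Sum>j\<in>dests D. \<Sum>M\<in>nests D. \<Sum>m\<in>M.
        \<Sum>r\<in>routes D i j m. ?x i j M m r * (\<Sum>a\<in>links D m. c m a * incidence D i j m r a))"
    by (subst sum.swap, intro sum.cong refl, rule sum.swap)
  finally show ?thesis .
qed

text \<open>The subtracted sum is stationary at \<open>q = p\<close>.\<close>

lemma objective_eq:
  "objective D q = total_value D (route_cost D p) q
    - (\<Sum>m\<in>modes D. \<Sum>a\<in>links D m. integral {0..link_flow D q m a} (link_cost D m a)
        - link_cost D m a (link_flow D p m a) * link_flow D q m a)"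
proof -
  have tau_swap: "(\<Sum>M\<in>nests D. tau D M * (\<Sum>i\<in>origins D. \<Sum>j\<in>dests D. f i j M))
      = (\<Sum>i\<in>origins D. \<Sum>j\<in>dests D. \<Sum>M\<in>nests D. tau D M * f i j M)"
    for f :: "_ \<Rightarrow> _ \<Rightarrow> _ \<Rightarrow> real"
    unfolding sum_distrib_left by (subst sum.swap, intro sum.cong refl, rule sum.swap)
  \<comment> \<open>Additivity of route costs: pricing the link flows of \<open>q\<close> at the
    link costs of \<open>p\<close> equals pricing its route flows at the route costs of
    \<open>p\<close>. This is the cost already subtracted inside \<open>total_value\<close>, so it
    must be added back.\<close>
  have route_costs: "(\<Sum>m\<in>modes D. \<Sum>a\<in>links D m.
        link_cost D m a (link_flow D p m a) * link_flow D q m a) =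
      (\<Sum>i\<in>origins D. \<Sum>j\<in>dests D. \<Sum>M\<in>nests D. \<Sum>m\<in>M. \<Sum>r\<in>routes D i j m.
        demand D i * dest_prob q i j * nest_prob q i j M * mode_in_nest_prob q i j M m
          * route_prob q i j m r * route_cost D p i j m r)"
    unfolding route_cost_def by (rule sum_link_flow)
  show ?thesis
    unfolding sum_subtractf route_costs objective_def tau_swap total_value_def origin_value_def
      dest_value_def nest_value_def route_value_def choice_value_def
    by (simp add: sum_distrib_left sum.distrib sum_subtractf sum_negf algebra_simps)
qed

section \<open>Feasibility and link flows along the perturbation\<close>

lemma eventually_perturbed_feasible:
  assumes "feasible D p"
  shows "\<forall>\<^sub>F t in nhds 0. feasible D (perturbed D G p t)"
  using assms origins(1) dests(1) finite_nests modes finite_nest routes(1)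
  unfolding feasible_def
  by (auto simp: perturbed_def eventually_conj_iff sum_replicator
      intro!: eventually_ball_finite eventually_replicator_pos)

lemma route_flow_pos:
  assumes "feasible D p" "i \<in> origins D" "j \<in> dests D" "M \<in> nests D" "m \<in> M" "r \<in> routes D i j m"
  shows "0 < demand D i * dest_prob p i j * nest_prob p i j M * mode_in_nest_prob p i j M m
    * route_prob p i j m r"
proof -
  have "m \<in> modes D"
    using nest_subset assms(4,5) by blast
  then show ?thesis
    using assms demand by (simp add: feasible_def)
qed

lemma obtain_nest:
  assumes "m \<in> modes D"
  obtains M where "M \<in> nests D" "m \<in> M"
  using assms nests by (auto simp: partition_on_def)

lemma link_flow_nonneg:
  assumes "feasible D p" "m \<in> modes D"
  shows "0 \<le> link_flow D p m a"
proof -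
  obtain M where M: "M \<in> nests D" "m \<in> M"
    using assms(2) by (rule obtain_nest)
  then show ?thesis
    unfolding link_flow_def nest_of_eq[OF M]
    by (intro sum_nonneg mult_nonneg_nonneg[OF less_imp_le[OF route_flow_pos[OF assms(1)]]])
      (simp_all add: incidence_def)
qed

text \<open>All route flows being positive, a link without flow lies on no route at all.\<close>

lemma link_flow_eq_0:
  assumes "feasible D p" "m \<in> modes D" "link_flow D p m a = 0"
  shows "link_flow D q m a = 0"
proof -
  obtain M where M: "M \<in> nests D" "m \<in> M"
    using assms(2) by (rule obtain_nest)
  define x where "x i j r = demand D i * dest_prob p i j * nest_prob p i j M
    * mode_in_nest_prob p i j M m * route_prob p i j m r" for i j r
  have pos: "0 < x i j r" if "i \<in> origins D" "j \<in> dests D" "r \<in> routes D i j m" for i j r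
    unfolding x_def using route_flow_pos[OF assms(1) that(1,2) M that(3)] .
  have nonneg: "0 \<le> x i j r * incidence D i j m r a"
    if "i \<in> origins D" "j \<in> dests D" "r \<in> routes D i j m" for i j r
    using pos[OF that] by (simp add: incidence_def)
  have "(\<Sum>i\<in>origins D. \<Sum>j\<in>dests D. \<Sum>r\<in>routes D i j m. x i j r * incidence D i j m r a) = 0"
    using assms(3) by (simp add: link_flow_def nest_of_eq[OF M] x_def)
  then have "incidence D i j m r a = 0"
    if "i \<in> origins D" "j \<in> dests D" "r \<in> routes D i j m" for i j r
    using that origins(1) dests(1) routes(1)[OF _ _ assms(2)] nonneg pos[OF that]
    by (simp add: sum_nonneg_eq_0_iff sum_nonneg) (metis less_irrefl)
  then show ?thesis
    by (simp add: link_flow_def)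
qed

lemma link_flow_perturbed_differentiable:
  assumes "m \<in> modes D"
  shows "(\<lambda>t. link_flow D (perturbed D G p t) m a) differentiable at 0"
  unfolding link_flow_def perturbed_def choice_probs.simps
  using origins(1) dests(1) routes(1)[OF _ _ assms]
  by (intro differentiable_sum ballI differentiable_mult differentiable_const
      replicator_differentiable) auto

text \<open>By the fundamental theorem of calculus and the chain rule the integral changes at the
  rate link cost times \<open>f'\<close>, which is exactly the rate of the subtracted linear
  term.\<close>

lemma link_integral_deriv:
  fixes G a
  assumes "feasible D p" "m \<in> modes D" "a \<in> links D m"
  defines "f \<equiv> \<lambda>t. link_flow D (perturbed D G p t) m a"
  shows "((\<lambda>t. integral {0..f t} (link_cost D m a) - link_cost D m a (link_flow D p m a) * f t)
    has_real_derivative 0) (at 0)"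
proof (cases "link_flow D p m a = 0")
  \<comment> \<open>Link costs are controlled on nonnegative flows only, so there is no two-sided
    derivative of the integral at flow 0. It is avoided: such a link stays without flow along the
    whole perturbation.\<close>
  case True
  then have "f t = 0" for t
    unfolding f_def using link_flow_eq_0 assms by blast
  then show ?thesis
    by simp
next
  case False
  have f0: "f 0 = link_flow D p m a"
    by (simp add: f_def)
  then have pos: "0 < f 0"
    using False link_flow_nonneg[OF assms(1,2), of a] by simp
  obtain f' where f': "(f has_real_derivative f') (at 0)"
    using link_flow_perturbed_differentiable[OF assms(2), of G p a]
    by (auto simp: f_def real_differentiable_def)
  \<comment> \<open>Any upper end beyond \<open>f 0\<close> would do: it makes \<open>f 0\<close> an
    interior point, so that the derivative within the interval is a full derivative.\<close>
  have "continuous_on {0..f 0 + 1} (link_cost D m a)"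
    using link_cost(1)[OF assms(2,3)] by (rule continuous_on_subset) auto
  then have "((\<lambda>x. integral {0..x} (link_cost D m a)) has_real_derivative link_cost D m a (f 0))
      (at (f 0) within {0..f 0 + 1})"
    using pos by (intro integral_has_real_derivative) auto
  then have "((\<lambda>x. integral {0..x} (link_cost D m a)) has_real_derivative link_cost D m a (f 0))
      (at (f 0))"
    using pos by (simp add: at_within_Icc_at)
  from DERIV_chain2[OF this f'] show ?thesis
    unfolding f0[symmetric] by (auto intro!: derivative_eq_intros f')
qed

section \<open>Stationarity at an optimum\<close>

lemma total_value_perturbed_deriv:
  fixes G p
  assumes "feasible D p"
  defines "\<rho> \<equiv> \<lambda>i j m r.
      - G i j m r - 1 / theta_route D * ln (route_prob p i j m r / path_size D i j m r)
      - route_value D G p i j m"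
    and "\<mu> \<equiv> \<lambda>i j M m. mode_utility D i j m + route_value D G p i j m
      - tau D M / theta_mode D * ln (mode_in_nest_prob p i j M m) - nest_value D G p i j M"
    and "\<nu> \<equiv> \<lambda>i j M. nest_value D G p i j M - 1 / theta_mode D * ln (nest_prob p i j M)
      - dest_value D G p i j"
    and "\<delta> \<equiv> \<lambda>i j. dest_utility D i j + dest_value D G p i j
      - 1 / theta_dest D * ln (dest_prob p i j) - origin_value D G p i"
  shows "((\<lambda>t. total_value D G (perturbed D G p t)) has_real_derivative
    (\<Sum>i\<in>origins D. demand D i * (\<Sum>j\<in>dests D. dest_prob p i j * ((\<delta> i j)\<^sup>2 +
      (\<Sum>M\<in>nests D. nest_prob p i j M * ((\<nu> i j M)\<^sup>2 +
        (\<Sum>m\<in>M. mode_in_nest_prob p i j M m * ((\<mu> i j M m)\<^sup>2 +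
          (\<Sum>r\<in>routes D i j m. route_prob p i j m r * (\<rho> i j m r)\<^sup>2))))))))) (at 0)"
proof -
  let ?p = "perturbed D G p"
  note feas = assms(1)[unfolded feasible_def]
  \<comment> \<open>The levels are treated from the bottom up, the derivative found at one level
    serving as \<open>v'\<close> at the next. It starts with \<open>v' = 0\<close>, as the route
    costs \<open>G\<close> are fixed.\<close>
  have route: "((\<lambda>t. route_value D G (?p t) i j m) has_real_derivative
      (\<Sum>r\<in>routes D i j m. route_prob p i j m r * (\<rho> i j m r)\<^sup>2)) (at 0)"
    if "i \<in> origins D" "j \<in> dests D" "m \<in> modes D" for i j m
    using choice_value_replicator_deriv[of "routes D i j m" "route_prob p i j m" "path_size D i j m"
        "\<lambda>t r. - G i j m r" "\<lambda>_. 0" "\<lambda>r. - G i j m r" "1 / theta_route D"]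
      that feas path_size_pos
    by (simp add: route_value_def perturbed_sel \<rho>_def)
  have nest: "((\<lambda>t. nest_value D G (?p t) i j M) has_real_derivative
      (\<Sum>m\<in>M. mode_in_nest_prob p i j M m * ((\<mu> i j M m)\<^sup>2 +
          (\<Sum>r\<in>routes D i j m. route_prob p i j m r * (\<rho> i j m r)\<^sup>2)))) (at 0)"
    if "i \<in> origins D" "j \<in> dests D" "M \<in> nests D" for i j M
    unfolding nest_value_def perturbed_sel \<mu>_def
    using that feas nest_subset
    by (intro choice_value_replicator_deriv_unweighted) (auto intro!: derivative_eq_intros route)
  have dest: "((\<lambda>t. dest_value D G (?p t) i j) has_real_derivative
      (\<Sum>M\<in>nests D. nest_prob p i j M * ((\<nu> i j M)\<^sup>2 +
        (\<Sum>m\<in>M. mode_in_nest_prob p i j M m * ((\<mu> i j M m)\<^sup>2 +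
          (\<Sum>r\<in>routes D i j m. route_prob p i j m r * (\<rho> i j m r)\<^sup>2)))))) (at 0)"
    if "i \<in> origins D" "j \<in> dests D" for i j
    unfolding dest_value_def perturbed_sel \<nu>_def
    using that feas
    by (intro choice_value_replicator_deriv_unweighted nest) auto
  have "((\<lambda>t. origin_value D G (?p t) i) has_real_derivative
      (\<Sum>j\<in>dests D. dest_prob p i j * ((\<delta> i j)\<^sup>2 +
        (\<Sum>M\<in>nests D. nest_prob p i j M * ((\<nu> i j M)\<^sup>2 +
          (\<Sum>m\<in>M. mode_in_nest_prob p i j M m * ((\<mu> i j M m)\<^sup>2 +
            (\<Sum>r\<in>routes D i j m. route_prob p i j m r * (\<rho> i j m r)\<^sup>2)))))))) (at 0)"
    if "i \<in> origins D" for i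
    unfolding origin_value_def perturbed_sel \<delta>_def
    using that feas
    by (intro choice_value_replicator_deriv_unweighted) (auto intro!: derivative_eq_intros dest)
  then show ?thesis
    unfolding total_value_def by (intro DERIV_sum DERIV_cmult)
qed

text \<open>Along the perturbation the objective differs from \<open>total_value\<close> by a
  function with derivative 0 at \<open>t = 0\<close>. Since \<open>t\<close> of either sign is
  feasible near 0, the optimum is a two-sided local maximum there.\<close>

lemma optimal_stationary:
  fixes p
  assumes "optimal_solution D p"
  defines "G \<equiv> route_cost D p"
  shows "((\<lambda>t. total_value D G (perturbed D G p t)) has_real_derivative d) (at 0) \<Longrightarrow> d = 0"
proof -
  let ?p = "perturbed D G p"
  have feas: "feasible D p" and opt: "feasible D q \<Longrightarrow> objective D q \<le> objective D p" for q
    using assms(1) by (auto simp: optimal_solution_def)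
  assume total: "((\<lambda>t. total_value D G (?p t)) has_real_derivative d) (at 0)"
  have "((\<lambda>t. \<Sum>m\<in>modes D. \<Sum>a\<in>links D m.
      integral {0..link_flow D (?p t) m a} (link_cost D m a)
        - link_cost D m a (link_flow D p m a) * link_flow D (?p t) m a)
      has_real_derivative (\<Sum>m\<in>modes D. \<Sum>a\<in>links D m. 0)) (at 0)"
    using link_integral_deriv[OF feas] by (intro DERIV_sum)
  from DERIV_diff[OF total this]
  have "((\<lambda>t. objective D (?p t)) has_real_derivative d) (at 0)"
    by (simp add: objective_eq[of _ p] G_def)
  moreover have "\<forall>\<^sub>F t in nhds 0. objective D (?p t) \<le> objective D (?p 0)"
    using eventually_perturbed_feasible[OF feas, of G]
    by eventually_elim (simp add: opt)
  then obtain e where "0 < e" "\<And>t. \<bar>t\<bar> < e \<Longrightarrow> objective D (?p t) \<le> objective D (?p 0)"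
    by (auto simp: eventually_nhds_metric dist_real_def)
  ultimately show "d = 0"
    by (intro DERIV_local_max[of _ d 0 e]) auto
qed

text \<open>The vanishing derivative is a nested sum of squares with positive weights. Descending
  from origins through destinations, nests and modes to routes, every square must be zero.\<close>

lemma optimal_terms_stationary:
  fixes p
  assumes "optimal_solution D p"
    and i: "i \<in> origins D" and j: "j \<in> dests D"
  defines "G \<equiv> route_cost D p"
  shows "dest_utility D i j + dest_value D G p i j - 1 / theta_dest D * ln (dest_prob p i j)
      = origin_value D G p i"
    and "M \<in> nests D \<Longrightarrow>
      nest_value D G p i j M - 1 / theta_mode D * ln (nest_prob p i j M) = dest_value D G p i j"
    and "\<lbrakk>M \<in> nests D; m \<in> M\<rbrakk> \<Longrightarrow>
      mode_utility D i j m + route_value D G p i j m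
        - tau D M / theta_mode D * ln (mode_in_nest_prob p i j M m) = nest_value D G p i j M"
    and "\<lbrakk>M \<in> nests D; m \<in> M; r \<in> routes D i j m\<rbrakk> \<Longrightarrow>
      - G i j m r - 1 / theta_route D * ln (route_prob p i j m r / path_size D i j m r)
        = route_value D G p i j m"
proof -
  define \<rho> where "\<rho> i j m r =
    - G i j m r - 1 / theta_route D * ln (route_prob p i j m r / path_size D i j m r)
      - route_value D G p i j m" for i j m r
  define \<mu> where "\<mu> i j M m = mode_utility D i j m + route_value D G p i j m
    - tau D M / theta_mode D * ln (mode_in_nest_prob p i j M m) - nest_value D G p i j M"
    for i j M m
  define \<nu> where "\<nu> i j M = nest_value D G p i j M - 1 / theta_mode D * ln (nest_prob p i j M)
    - dest_value D G p i j" for i j M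
  define \<delta> where "\<delta> i j = dest_utility D i j + dest_value D G p i j
    - 1 / theta_dest D * ln (dest_prob p i j) - origin_value D G p i" for i j
  \<comment> \<open>\<open>R\<close>, \<open>Q\<close>, \<open>N\<close> and \<open>T\<close>
    collect the weighted squares at and below the route, mode, nest and destination level.\<close>
  define R where "R i j m = (\<Sum>r\<in>routes D i j m. route_prob p i j m r * (\<rho> i j m r)\<^sup>2)" for i j m
  define Q where "Q i j M = (\<Sum>m\<in>M. mode_in_nest_prob p i j M m * ((\<mu> i j M m)\<^sup>2 + R i j m))"
    for i j M
  define N where "N i j = (\<Sum>M\<in>nests D. nest_prob p i j M * ((\<nu> i j M)\<^sup>2 + Q i j M))" for i j
  define T where "T i = (\<Sum>j\<in>dests D. dest_prob p i j * ((\<delta> i j)\<^sup>2 + N i j))" for i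
  have feas: "feasible D p"
    using assms(1) by (simp add: optimal_solution_def)
  note pos = feas[unfolded feasible_def]
  have R: "0 \<le> R i j m" if "i \<in> origins D" "j \<in> dests D" "m \<in> modes D" for i j m
    unfolding R_def using that pos by (auto intro!: sum_nonneg simp: less_imp_le)
  have Q: "0 \<le> Q i j M" if "i \<in> origins D" "j \<in> dests D" "M \<in> nests D" for i j M
    unfolding Q_def using that pos R[OF that(1,2)] nest_subset[OF that(3)]
    by (intro sum_nonneg mult_nonneg_nonneg add_nonneg_nonneg) (auto simp: less_imp_le)
  have N: "0 \<le> N i j" if "i \<in> origins D" "j \<in> dests D" for i j
    unfolding N_def using that pos Q
    by (intro sum_nonneg mult_nonneg_nonneg add_nonneg_nonneg) (auto simp: less_imp_le)
  have T: "0 \<le> T i" if "i \<in> origins D" for i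
    unfolding T_def using that pos N
    by (intro sum_nonneg mult_nonneg_nonneg add_nonneg_nonneg) (auto simp: less_imp_le)
  have "(\<Sum>i\<in>origins D. demand D i * T i) = 0"
    using optimal_stationary[OF assms(1) total_value_perturbed_deriv[OF feas]]
    unfolding T_def N_def Q_def R_def \<rho>_def \<mu>_def \<nu>_def \<delta>_def G_def .
  then have "T i = 0"
    using weighted_squares_zero[of "origins D" "demand D" "\<lambda>_. 0" T i]
      origins(1) demand T i by simp
  then have \<delta>N: "\<delta> i j = 0" "N i j = 0"
    unfolding T_def using weighted_squares_zero[of "dests D" "dest_prob p i" "\<delta> i" "N i" j]
      dests(1) pos N i j by auto
  then have \<nu>Q: "\<nu> i j M = 0" "Q i j M = 0" if "M \<in> nests D" for M
    unfolding N_def using weighted_squares_zero[of "nests D" "nest_prob p i j" "\<nu> i j" "Q i j" M]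
      finite_nests pos Q i j that by auto
  then have \<mu>R: "\<mu> i j M m = 0" "R i j m = 0" if "M \<in> nests D" "m \<in> M" for M m
    unfolding Q_def
    using weighted_squares_zero[of M "mode_in_nest_prob p i j M" "\<mu> i j M" "R i j" m]
      finite_nest pos R[OF i j subsetD[OF nest_subset[OF that(1)]]] i j that by auto
  then have \<rho>: "\<rho> i j m r = 0" if "M \<in> nests D" "m \<in> M" "r \<in> routes D i j m" for M m r
    unfolding R_def
    using weighted_squares_zero[of "routes D i j m" "route_prob p i j m" "\<rho> i j m" "\<lambda>_. 0" r]
      routes(1)[OF i j] nest_subset[OF that(1)] pos i j that by auto
  show "dest_utility D i j + dest_value D G p i j - 1 / theta_dest D * ln (dest_prob p i j)
      = origin_value D G p i"
    using \<delta>N(1) by (simp add: \<delta>_def)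
  show "nest_value D G p i j M - 1 / theta_mode D * ln (nest_prob p i j M) = dest_value D G p i j"
    if "M \<in> nests D"
    using \<nu>Q(1)[OF that] by (simp add: \<nu>_def)
  show "mode_utility D i j m + route_value D G p i j m
      - tau D M / theta_mode D * ln (mode_in_nest_prob p i j M m) = nest_value D G p i j M"
    if "M \<in> nests D" "m \<in> M"
    using \<mu>R(1)[OF that] by (simp add: \<mu>_def)
  show "- G i j m r - 1 / theta_route D * ln (route_prob p i j m r / path_size D i j m r)
      = route_value D G p i j m"
    if "M \<in> nests D" "m \<in> M" "r \<in> routes D i j m"
    using \<rho>[OF that] by (simp add: \<rho>_def)
qed

section \<open>The logit formulas, from routes up to destinations\<close>

lemma optimal_route_choice:
  assumes "optimal_solution D p" "i \<in> origins D" "j \<in> dests D" "M \<in> nests D" "m \<in> M"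
  shows "r \<in> routes D i j m \<Longrightarrow> route_prob p i j m r =
      path_size D i j m r * exp (theta_route D * route_utility D p i j m r)
        / (\<Sum>r'\<in>routes D i j m.
            path_size D i j m r' * exp (theta_route D * route_utility D p i j m r'))"
    and "route_value D (route_cost D p) p i j m = route_logsum D p i j m"
proof -
  let ?K = "routes D i j m" and ?c = "1 / theta_route D" and ?w = "path_size D i j m"
    and ?v = "\<lambda>r. - route_cost D p i j m r" and ?x = "route_prob p i j m"
  have m: "m \<in> modes D"
    using nest_subset assms by blast
  have feas: "feasible D p"
    using assms(1) by (simp add: optimal_solution_def)
  \<comment> \<open>These are the hypotheses of \<open>stationary_choice_logit\<close>. Its first
    conclusion gives the choice probability, its second the logsum that the mode level takes as part
    of its utility.\<close>
  have *: "0 < ?c" "\<And>r. r \<in> ?K \<Longrightarrow> 0 < ?x r" "\<And>r. r \<in> ?K \<Longrightarrow> 0 < ?w r"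
    "(\<Sum>r\<in>?K. ?x r) = 1"
    "\<And>r. r \<in> ?K \<Longrightarrow> ?v r - ?c * ln (?x r / ?w r) = choice_value ?K ?c ?w ?v ?x"
    using feas theta path_size_pos assms m
      optimal_terms_stationary(4)[OF assms(1-5)]
    by (auto simp: feasible_def route_value_def)
  show "?x r = ?w r * exp (theta_route D * route_utility D p i j m r)
      / (\<Sum>r'\<in>?K. ?w r' * exp (theta_route D * route_utility D p i j m r'))" if "r \<in> ?K"
    using stationary_choice_prob[OF * that] by (simp add: route_utility_def mult.commute)
  show "route_value D (route_cost D p) p i j m = route_logsum D p i j m"
    using stationary_choice_value[OF *]
    by (simp add: route_value_def route_logsum_def route_utility_def mult.commute)
qed

text \<open>Here \<open>c = tau D M / theta_mode D\<close>, whereas the inclusive value multiplies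
  the logarithm by \<open>tau D M\<close> alone; hence the division by \<open>theta_mode D\<close>.
  One level up, the factor \<open>1 / theta_mode D\<close> of the nest entropy cancels it, leaving
  the bare inclusive value in the exponent.\<close>

lemma optimal_mode_choice:
  assumes "optimal_solution D p" "i \<in> origins D" "j \<in> dests D" "M \<in> nests D"
  shows "m \<in> M \<Longrightarrow> mode_in_nest_prob p i j M m =
      exp (theta_mode D * (mode_utility D i j m + route_logsum D p i j m) / tau D M)
        / (\<Sum>m'\<in>M. exp (theta_mode D * (mode_utility D i j m' + route_logsum D p i j m') / tau D M))"
    and "nest_value D (route_cost D p) p i j M = nest_inclusive_value D p i j M / theta_mode D"
proof -
  let ?c = "tau D M / theta_mode D" and ?x = "mode_in_nest_prob p i j M"
    and ?v = "\<lambda>m. mode_utility D i j m + route_value D (route_cost D p) p i j m"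
  have feas: "feasible D p"
    using assms(1) by (simp add: optimal_solution_def)
  have *: "0 < ?c" "\<And>m. m \<in> M \<Longrightarrow> 0 < ?x m" "\<And>m. m \<in> M \<Longrightarrow> 0 < (1::real)"
    "(\<Sum>m\<in>M. ?x m) = 1"
    "\<And>m. m \<in> M \<Longrightarrow> ?v m - ?c * ln (?x m / 1) = choice_value M ?c (\<lambda>_. 1) ?v ?x"
    using feas theta tau assms optimal_terms_stationary(3)[OF assms]
    by (auto simp: feasible_def nest_value_def)
  have v: "?v m / ?c = theta_mode D * (mode_utility D i j m + route_logsum D p i j m) / tau D M"
    if "m \<in> M" for m
    using optimal_route_choice(2)[OF assms that] by simp
  \<comment> \<open>The factor 1 is the constant weight \<open>w\<close>, kept to match the
    denominator of \<open>stationary_choice_prob\<close>.\<close>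
  have s: "(\<Sum>m\<in>M. 1 * exp (?v m / ?c))
      = (\<Sum>m\<in>M. exp (theta_mode D * (mode_utility D i j m + route_logsum D p i j m) / tau D M))"
    by (rule sum.cong) (simp_all only: v mult_1)
  show "?x m = exp (theta_mode D * (mode_utility D i j m + route_logsum D p i j m) / tau D M)
      / (\<Sum>m'\<in>M. exp (theta_mode D * (mode_utility D i j m' + route_logsum D p i j m') / tau D M))"
    if "m \<in> M"
    using stationary_choice_prob[OF * that] unfolding s v[OF that] by simp
  show "nest_value D (route_cost D p) p i j M = nest_inclusive_value D p i j M / theta_mode D"
    using stationary_choice_value[OF *] unfolding s
    by (simp add: nest_value_def nest_inclusive_value_def)
qed

lemma optimal_nest_choice:
  assumes "optimal_solution D p" "i \<in> origins D" "j \<in> dests D"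
  shows "M \<in> nests D \<Longrightarrow> nest_prob p i j M =
      exp (nest_inclusive_value D p i j M) / (\<Sum>M'\<in>nests D. exp (nest_inclusive_value D p i j M'))"
    and "dest_value D (route_cost D p) p i j = mode_logsum D p i j"
proof -
  let ?c = "1 / theta_mode D" and ?x = "nest_prob p i j"
    and ?v = "nest_value D (route_cost D p) p i j"
  have feas: "feasible D p"
    using assms(1) by (simp add: optimal_solution_def)
  have *: "0 < ?c" "\<And>M. M \<in> nests D \<Longrightarrow> 0 < ?x M"
    "\<And>M. M \<in> nests D \<Longrightarrow> 0 < (1::real)" "(\<Sum>M\<in>nests D. ?x M) = 1"
    "\<And>M. M \<in> nests D \<Longrightarrow> ?v M - ?c * ln (?x M / 1) = choice_value (nests D) ?c (\<lambda>_. 1) ?v ?x"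
    using feas theta assms optimal_terms_stationary(2)[OF assms]
    by (auto simp: feasible_def dest_value_def)
  have v: "?v M / ?c = nest_inclusive_value D p i j M" if "M \<in> nests D" for M
    using optimal_mode_choice(2)[OF assms that] theta by simp
  show "?x M = exp (nest_inclusive_value D p i j M)
      / (\<Sum>M'\<in>nests D. exp (nest_inclusive_value D p i j M'))" if "M \<in> nests D"
    using stationary_choice_prob[OF * that] v that by simp
  show "dest_value D (route_cost D p) p i j = mode_logsum D p i j"
    using stationary_choice_value[OF *] v by (simp add: dest_value_def mode_logsum_def)
qed

lemma optimal_dest_choice:
  assumes "optimal_solution D p" "i \<in> origins D" "j \<in> dests D"
  shows "dest_prob p i j =
      exp (theta_dest D * (dest_utility D i j + mode_logsum D p i j))
        / (\<Sum>j'\<in>dests D. exp (theta_dest D * (dest_utility D i j' + mode_logsum D p i j')))"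
proof -
  let ?c = "1 / theta_dest D" and ?x = "dest_prob p i"
    and ?v = "\<lambda>j. dest_utility D i j + dest_value D (route_cost D p) p i j"
  have feas: "feasible D p"
    using assms(1) by (simp add: optimal_solution_def)
  have *: "0 < ?c" "\<And>j. j \<in> dests D \<Longrightarrow> 0 < ?x j"
    "\<And>j. j \<in> dests D \<Longrightarrow> 0 < (1::real)" "(\<Sum>j\<in>dests D. ?x j) = 1"
    "\<And>j. j \<in> dests D \<Longrightarrow> ?v j - ?c * ln (?x j / 1) = choice_value (dests D) ?c (\<lambda>_. 1) ?v ?x"
    using feas theta assms optimal_terms_stationary(1)[OF assms(1,2)]
    by (auto simp: feasible_def origin_value_def)
  have v: "?v j / ?c = theta_dest D * (dest_utility D i j + mode_logsum D p i j)"
    if "j \<in> dests D" for j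
    using optimal_nest_choice(2)[OF assms(1,2) that] by simp
  have s: "(\<Sum>j\<in>dests D. 1 * exp (?v j / ?c))
      = (\<Sum>j\<in>dests D. exp (theta_dest D * (dest_utility D i j + mode_logsum D p i j)))"
    by (rule sum.cong) (simp_all only: v mult_1)
  show ?thesis
    using stationary_choice_prob[OF * assms(3)] unfolding s v[OF assms(3)] by simp
qed

end

theorem corollary1:
  fixes D :: "('i, 'j, 'm, 'a, 'r, 'k, 'q) network_data"
    and p :: "('i, 'j, 'm, 'r) choice_probs"
  assumes "second_stage_data D"
    and "optimal_solution D p"
  shows "\<forall>i\<in>origins D. \<forall>j\<in>dests D. \<forall>M\<in>nests D. \<forall>m\<in>M. \<forall>r\<in>routes D i j m.
    dest_prob p i j =
      exp (theta_dest D * (dest_utility D i j + mode_logsum D p i j))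
        / (\<Sum>j'\<in>dests D. exp (theta_dest D * (dest_utility D i j' + mode_logsum D p i j')))
    \<and> nest_prob p i j M =
      exp (nest_inclusive_value D p i j M)
        / (\<Sum>M'\<in>nests D. exp (nest_inclusive_value D p i j M'))
    \<and> mode_in_nest_prob p i j M m =
      exp (theta_mode D * (mode_utility D i j m + route_logsum D p i j m) / tau D M)
        / (\<Sum>m'\<in>M. exp (theta_mode D * (mode_utility D i j m' + route_logsum D p i j m') / tau D M))
    \<and> route_prob p i j m r =
      path_size D i j m r * exp (theta_route D * route_utility D p i j m r)
        / (\<Sum>r'\<in>routes D i j m.
            path_size D i j m r' * exp (theta_route D * route_utility D p i j m r'))
    \<and> mode_prob D p i j m = nest_prob p i j M * mode_in_nest_prob p i j M m"
proof -
  interpret second_stage_data D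
    by (rule assms(1))
  show ?thesis
    using assms(2)
    by (intro ballI conjI optimal_dest_choice optimal_nest_choice(1) optimal_mode_choice(1)
        optimal_route_choice(1) mode_prob_eq)
qed

end
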